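(* Let $G$ be a finite simple connected graph with at least one edge. Then the edge ideal $I(G)$ is Lyubeznik (i.e., admits a minimal Lyubeznik resolution) if and only if $G$ is (isomorphic to) $L(a,b,c)$ for some nonnegative integers $a,b,c$.
   Context: Let $\Bbbk$ be a field. For a graph $G=(V,E)$ let $S=\Bbbk[V]$ be the polynomial ring whose variables are the vertices of $G$; the edge ideal is $I(G)=\langle xy : \{x,y\}\in E\rangle\subseteq S$. The graph $L(a,b,c)$ (for nonnegative integers $a,b,c$) has vertex set $\{x,y\}\sqcup\{x_i\}_{i=1}^a\sqcup\{y_j\}_{j=1}^b\sqcup\{z_k\}_{k=1}^c$ and edge set $\{xy\}\sqcup\{xx_i\}_{i=1}^a\sqcup\{yy_j\}_{j=1}^b\sqcup\{xz_k\}_{k=1}^c\sqcup\{yz_k\}_{k=1}^c$. Lyubeznik ideals. For a monomial ideal $I\subseteq S$ let $\mathrm{Gens}(I)$ be its set of minimal monomial generators. Fix a total order $(\succ)$ on $\mathrm{Gens}(I)$. A subset $\sigma=\{m_1\succ\cdots\succ m_k\}$ of $\mathrm{Gens}(I)$ is Lyubeznik-critical if there is no $m\in\mathrm{Gens}(I)$ and no $t$ with $1<t\le k$ such that $m_t\succ m$ and $m\mid\mathrm{lcm}(m_1,\dots,m_t)$. The Lyubeznik resolution of $S/I$ with respect to $(\succ)$ is the subcomplex of the Taylor resolution whose $i$-th module has as basis the Lyubeznik-critical subsets with exactly $i$ elements, with differential $\partial(\sigma)=\sum_{\tau\subseteq\sigma,\,|\tau|=|\sigma|-1}\pm\frac{\mathrm{lcm}(\sigma)}{\mathrm{lcm}(\tau)}\tau$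 (Taylor signs); it is a free resolution of $S/I$. It is minimal if the image of $\partial$ lies in the ideal of variables times the complex; equivalently, if no Lyubeznik-critical $\sigma$ contains an element $m$ with $\mathrm{lcm}(\sigma\setminus\{m\})=\mathrm{lcm}(\sigma)$. The ideal $I$ is called Lyubeznik if for some total order on $\mathrm{Gens}(I)$ the corresponding Lyubeznik resolution is minimal. *)

theory Defs
  imports
    "HOL-Library.Poly_Mapping"
    "HOL-Library.Multiset"
    "HOL-Algebra.Ideal"
    "Graph_Theory.Graph_Theory"
begin

text \<open>
  Monomials in variables of type \<^typ>\<open>'v\<close> are finite multisets of variables: the product of monomials
  is \<open>+\<close>, divisibility is \<open>\<subseteq>#\<close>, the quotient of a monomial by a divisor is \<open>-\<close>, and the least common
  multiple of a finite set of monomials is its \<^const>\<open>Sup\<close> (with \<open>Sup {} = {#}\<close>, the monomial 1).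
  Polynomials are finitely supported coefficient functions on monomials, i.e. the elements of the
  monoid algebra of the free commutative monoid.
\<close>

type_synonym ('v, 'k) mpoly = "'v multiset \<Rightarrow>\<^sub>0 'k"

abbreviation monomial :: "'v multiset \<Rightarrow> ('v, 'k::zero_neq_one) mpoly" where
  "monomial m \<equiv> Poly_Mapping.single m 1"

definition poly_ring :: "'v set \<Rightarrow> ('v, 'k::field) mpoly ring" where
  "poly_ring V =
    \<lparr>carrier = {p. \<forall>m\<in>Poly_Mapping.keys p. set_mset m \<subseteq> V},
     monoid.mult = (*), one = 1, zero = 0, add = (+)\<rparr>"

lemma cring_poly_ring: "cring (poly_ring V :: ('v, 'k::field) mpoly ring)"
proof (rule cringI)
  let ?R = "poly_ring V :: ('v, 'k) mpoly ring"
  show "abelian_group ?R"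
  proof (rule abelian_groupI)
    fix x y assume "x \<in> carrier ?R" "y \<in> carrier ?R"
    then show "x \<oplus>\<^bsub>?R\<^esub> y \<in> carrier ?R"
      using Poly_Mapping.keys_add[of x y] by (auto simp: poly_ring_def)
  next
    fix x assume "x \<in> carrier ?R"
    then show "\<exists>y\<in>carrier ?R. y \<oplus>\<^bsub>?R\<^esub> x = \<zero>\<^bsub>?R\<^esub>"
      by (intro bexI[of _ "- x"]) (auto simp: poly_ring_def)
  qed (auto simp: poly_ring_def ac_simps)
  show "Group.comm_monoid ?R"
  proof (rule Group.comm_monoidI)
    fix x y assume "x \<in> carrier ?R" "y \<in> carrier ?R"
    then show "x \<otimes>\<^bsub>?R\<^esub> y \<in> carrier ?R"
      using keys_mult[of x y] by (fastforce simp: poly_ring_def)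
  qed (auto simp: poly_ring_def ac_simps)
qed (auto simp: poly_ring_def distrib_right)

text \<open>
  A finite simple graph is a \<^const>\<open>pair_graph\<close>; each edge is represented by its two opposite arcs,
  which give the same generator of the edge ideal.
\<close>

definition edge_ideal :: "'v pair_pre_digraph \<Rightarrow> ('v, 'k::field) mpoly set" where
  "edge_ideal G = Idl\<^bsub>poly_ring (pverts G)\<^esub> {monomial {#u, v#} | u v. (u, v) \<in> parcs G}"

definition var_ideal :: "'v set \<Rightarrow> ('v, 'k::field) mpoly set" where
  "var_ideal V = Idl\<^bsub>poly_ring V\<^esub> {monomial {#v#} | v. v \<in> V}"

text \<open>
  The minimal monomial generators of a monomial ideal are its divisibility-minimal monomials.
\<close>

definition Gens :: "('v, 'k::field) mpoly set \<Rightarrow> 'v multiset set" where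
  "Gens I = {m. monomial m \<in> I \<and> (\<forall>n. monomial n \<in> I \<longrightarrow> n \<subseteq># m \<longrightarrow> n = m)}"

text \<open>Below, \<open>(m, n) \<in> r\<close> means that \<open>m\<close> precedes \<open>n\<close> in the listing, i.e. \<open>m \<succ> n\<close>.\<close>

definition lyubeznik_critical ::
    "'v multiset rel \<Rightarrow> ('v, 'k::field) mpoly set \<Rightarrow> 'v multiset set \<Rightarrow> bool" where
  "lyubeznik_critical r I \<sigma> \<longleftrightarrow> \<sigma> \<subseteq> Gens I \<and>
     (\<exists>ms. sorted_wrt (\<lambda>m n. (m, n) \<in> r) ms \<and> set ms = \<sigma> \<and>
       \<not> (\<exists>m\<in>Gens I. \<exists>t. 1 < t \<and> t \<le> length ms \<and>
            (ms ! (t - 1), m) \<in> r \<and> m \<subseteq># Sup (set (take t ms))))"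

text \<open>
  Chains are finitely supported families of polynomials indexed by sets of monomials, so that
  \<open>Poly_Mapping.single \<sigma> p\<close> is the multiple \<open>p \<sigma>\<close> of the basis element \<open>\<sigma>\<close>.
\<close>

definition lyubeznik_module ::
    "'v set \<Rightarrow> 'v multiset rel \<Rightarrow> ('v, 'k::field) mpoly set \<Rightarrow> nat
      \<Rightarrow> ('v multiset set \<Rightarrow>\<^sub>0 ('v, 'k) mpoly) set" where
  "lyubeznik_module V r I i =
    {f. \<forall>\<sigma>\<in>Poly_Mapping.keys f. lyubeznik_critical r I \<sigma> \<and> card \<sigma> = i \<and>
          Poly_Mapping.lookup f \<sigma> \<in> carrier (poly_ring V)}"

text \<open>
  For \<open>\<sigma> = {m\<^sub>1 \<succ> \<dots> \<succ> m\<^sub>k}\<close> the face \<open>\<sigma> - {m\<^sub>j}\<close> carries the Taylor sign \<open>(-1)\<close> to the power \<open>j - 1\<close>.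
\<close>

definition taylor_differential ::
    "'v multiset rel \<Rightarrow> ('v multiset set \<Rightarrow>\<^sub>0 ('v, 'k::field) mpoly)
      \<Rightarrow> ('v multiset set \<Rightarrow>\<^sub>0 ('v, 'k) mpoly)" where
  "taylor_differential r f =
    (\<Sum>\<sigma>\<in>Poly_Mapping.keys f. \<Sum>m\<in>\<sigma>.
       Poly_Mapping.single (\<sigma> - {m})
         (Poly_Mapping.lookup f \<sigma> *
          Poly_Mapping.single (Sup \<sigma> - Sup (\<sigma> - {m})) ((- 1) ^ card {n\<in>\<sigma>. (n, m) \<in> r})))"

definition ideal_times_module ::
    "('v, 'k::field) mpoly set \<Rightarrow> ('b \<Rightarrow>\<^sub>0 ('v, 'k) mpoly) set \<Rightarrow> ('b \<Rightarrow>\<^sub>0 ('v, 'k) mpoly) set" where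
  "ideal_times_module J M =
    {\<Sum>i<n. Poly_Mapping.map (\<lambda>q. a i * q) (f i) | (n::nat) a f. \<forall>i<n. a i \<in> J \<and> f i \<in> M}"

text \<open>
  The differential of the degree 0 module is zero, so only positive degrees matter.
\<close>

definition minimal_lyubeznik_resolution ::
    "'v set \<Rightarrow> 'v multiset rel \<Rightarrow> ('v, 'k::field) mpoly set \<Rightarrow> bool" where
  "minimal_lyubeznik_resolution V r I \<longleftrightarrow>
    (\<forall>i. taylor_differential r ` lyubeznik_module V r I (Suc i)
           \<subseteq> ideal_times_module (var_ideal V) (lyubeznik_module V r I i))"

definition lyubeznik_ideal :: "'v set \<Rightarrow> ('v, 'k::field) mpoly set \<Rightarrow> bool" where
  "lyubeznik_ideal V I \<longleftrightarrow>
    (\<exists>r. strict_linear_order_on (Gens I) r \<and> minimal_lyubeznik_resolution V r I)"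

datatype L_vertex = LX | LY | LXi nat | LYj nat | LZk nat

definition L_graph :: "nat \<Rightarrow> nat \<Rightarrow> nat \<Rightarrow> L_vertex pair_pre_digraph" where
  "L_graph a b c =
    (let E = {(LX, LY)} \<union> {(LX, LXi i) | i. i \<in> {1..a}} \<union> {(LY, LYj j) | j. j \<in> {1..b}}
             \<union> {(LX, LZk k) | k. k \<in> {1..c}} \<union> {(LY, LZk k) | k. k \<in> {1..c}}
     in \<lparr>pverts = {LX, LY} \<union> LXi ` {1..a} \<union> LYj ` {1..b} \<union> LZk ` {1..c},
         parcs = E \<union> E\<inverse>\<rparr>)"

end

theory Submission
  imports Defs
begin

text \<open>
  Both sides of the equivalence say that some edge \<open>xy\<close> meets every edge, or in other words that no edge
  is disjoint from \<open>{x, y}\<close>. For \<open>L(a, b, c)\<close> this is visible. Conversely, if \<open>xy\<close> meets every edge of a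
  connected graph, then each remaining vertex is adjacent to \<open>x\<close> only, to \<open>y\<close> only, or to both, and to
  nothing else; the sizes of these three classes are \<open>a\<close>, \<open>b\<close> and \<open>c\<close>.

  On the algebraic side, the resolution is minimal iff no critical set \<open>\<sigma>\<close> has an element \<open>m\<close> dividing
  the lcm of the others (lemma \<open>minimal_lyubeznik_resolution_iff\<close>), because the coefficient of
  \<open>\<sigma> - {m}\<close> in \<open>\<partial>\<sigma>\<close> is, up to sign, the monomial \<open>lcm(\<sigma>) / lcm(\<sigma> - {m})\<close>. Moreover \<open>\<sigma>\<close> is critical
  iff no generator \<open>m\<close> divides the lcm of the elements of \<open>\<sigma>\<close> listed before \<open>m\<close>
  (lemma \<open>lyubeznik_critical_iff\<close>). For edges, dividing an lcm means being covered by a union of edges.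

  Suppose that \<open>xy\<close> meets every edge, and list it last. An edge of \<open>\<sigma>\<close> that is covered by the other edges
  of \<open>\<sigma>\<close> forces both \<open>x\<close> and \<open>y\<close> to lie on edges of \<open>\<sigma>\<close> other than \<open>xy\<close>; these precede \<open>xy\<close>, so \<open>\<sigma>\<close> is
  not critical (lemma \<open>covering_edge_dvd_if_redundant\<close>).

  Suppose conversely that an order gives a minimal resolution, and let \<open>xy\<close> be the last edge. If some edge
  were disjoint from it, connectedness would give, up to exchanging \<open>x\<close> and \<open>y\<close>, a path \<open>x y c d\<close>. Its
  middle edge is covered by the outer two, so \<open>{xy, yc, cd}\<close> cannot be critical; as \<open>xy\<close> precedes no
  edge, the only edge that can spoil criticality is \<open>yd\<close>, which must then exist and come after \<open>yc\<close>
  (lemma \<open>path_from_last_edge\<close>). Now \<open>x y d c\<close> is a path as well, and the same argument puts \<open>yc\<close> after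
  \<open>yd\<close>, a contradiction.
\<close>

section \<open>Ideals generated by monomials\<close>

lemma poly_ring_simps [simp]:
  "p \<in> carrier (poly_ring V) \<longleftrightarrow> (\<forall>m\<in>Poly_Mapping.keys p. set_mset m \<subseteq> V)"
  "monoid.mult (poly_ring V) = (*)" "one (poly_ring V) = 1"
  "zero (poly_ring V) = 0" "add (poly_ring V) = (+)"
  by (auto simp: poly_ring_def)

text \<open>
  The polynomials all of whose monomials are multiples of elements of \<open>A\<close> form an ideal that contains
  the generators, hence the whole generated ideal.
\<close>

lemma keys_of_monomial_ideal:
  fixes p :: "('v, 'k::field) mpoly"
  assumes A: "\<And>a. a \<in> A \<Longrightarrow> set_mset a \<subseteq> V"
    and p: "p \<in> Idl\<^bsub>poly_ring V\<^esub> (monomial ` A)" and m: "m \<in> Poly_Mapping.keys p"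
  obtains a where "a \<in> A" "a \<subseteq># m"
proof -
  let ?R = "poly_ring V :: ('v, 'k) mpoly ring"
  interpret cring ?R by (rule cring_poly_ring)
  define J where "J = {p \<in> carrier ?R. \<forall>m\<in>Poly_Mapping.keys p. \<exists>a\<in>A. a \<subseteq># m}"
  have mult: "q * p \<in> J" if "p \<in> J" "q \<in> carrier ?R" for p q
  proof -
    have "q * p \<in> carrier ?R"
      using m_closed[of q p] that by (auto simp: J_def)
    moreover have "\<exists>a\<in>A. a \<subseteq># m" if m: "m \<in> Poly_Mapping.keys (q * p)" for m
    proof -
      obtain k l where "m = k + l" "l \<in> Poly_Mapping.keys p"
        using m keys_mult[of q p] by blast
      moreover from this obtain a where "a \<in> A" "a \<subseteq># l"
        using \<open>p \<in> J\<close> by (auto simp: J_def)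
      ultimately show ?thesis
        by (metis add.commute mset_subset_eq_add_left subset_mset.trans)
    qed
    ultimately show ?thesis unfolding J_def by blast
  qed
  have "ideal J ?R"
  proof (rule idealI)
    show "ring ?R" by (rule ring_axioms)
    show "subgroup J (add_monoid ?R)"
    proof
      show "J \<subseteq> carrier (add_monoid ?R)" by (auto simp: J_def)
      show "\<one>\<^bsub>add_monoid ?R\<^esub> \<in> J" by (auto simp: J_def)
      fix p q assume "p \<in> J" "q \<in> J"
      then show "p \<otimes>\<^bsub>add_monoid ?R\<^esub> q \<in> J"
        using Poly_Mapping.keys_add[of p q] by (fastforce simp: J_def)
    next
      fix p assume p: "p \<in> J"
      then have "- p \<in> J" by (auto simp: J_def)
      moreover have "inv\<^bsub>add_monoid ?R\<^esub> p = - p"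
        using p a_inv_def[of ?R] minus_equality[of "- p" p] by (auto simp: J_def)
      ultimately show "inv\<^bsub>add_monoid ?R\<^esub> p \<in> J" by simp
    qed
    fix p q assume pq: "p \<in> J" "q \<in> carrier ?R"
    show "q \<otimes>\<^bsub>?R\<^esub> p \<in> J" using mult[OF pq] by simp
    show "p \<otimes>\<^bsub>?R\<^esub> q \<in> J" using mult[OF pq] by (simp add: mult.commute)
  qed
  moreover have "monomial ` A \<subseteq> J" using A by (fastforce simp: J_def)
  ultimately have "p \<in> J" using genideal_minimal p by blast
  with m that show thesis by (auto simp: J_def)
qed

lemma single_in_monomial_ideal:
  fixes A :: "'v multiset set" and c :: "'k::field"
  assumes A: "\<And>a. a \<in> A \<Longrightarrow> set_mset a \<subseteq> V"
    and "a \<in> A" "a \<subseteq># m" "set_mset m \<subseteq> V"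
  shows "Poly_Mapping.single m c \<in> Idl\<^bsub>poly_ring V\<^esub> (monomial ` A)"
proof -
  let ?R = "poly_ring V :: ('v, 'k) mpoly ring"
  interpret cring ?R by (rule cring_poly_ring)
  have sub: "monomial ` A \<subseteq> carrier ?R" using A by auto
  interpret I: ideal "Idl\<^bsub>?R\<^esub> (monomial ` A)" ?R by (rule genideal_ideal[OF sub])
  have "monomial a \<in> Idl\<^bsub>?R\<^esub> (monomial ` A)"
    using genideal_self[OF sub] \<open>a \<in> A\<close> by auto
  moreover have "Poly_Mapping.single (m - a) c \<in> carrier ?R"
    using \<open>set_mset m \<subseteq> V\<close> by (auto dest: in_diffD)
  ultimately have "Poly_Mapping.single (m - a) c * monomial a \<in> Idl\<^bsub>?R\<^esub> (monomial ` A)"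
    using I.I_l_closed by fastforce
  then show ?thesis using \<open>a \<subseteq># m\<close> by (simp add: mult_single)
qed

text \<open>
  This identifies the minimal generators of edge ideals, since distinct edges do not divide each other.
\<close>

lemma Gens_monomial_ideal:
  assumes A: "\<And>a. a \<in> A \<Longrightarrow> set_mset a \<subseteq> V"
    and antichain: "\<And>a b. a \<in> A \<Longrightarrow> b \<in> A \<Longrightarrow> a \<subseteq># b \<Longrightarrow> a = b"
  shows "Gens (Idl\<^bsub>poly_ring V\<^esub> (monomial ` A) :: ('v, 'k::field) mpoly set) = A"
proof -
  let ?I = "Idl\<^bsub>poly_ring V\<^esub> (monomial ` A) :: ('v, 'k) mpoly set"
  have in_I: "monomial a \<in> ?I" if "a \<in> A" for a
    using single_in_monomial_ideal[OF A that] A that by blast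
  have divisor: "\<exists>a\<in>A. a \<subseteq># m" if "monomial m \<in> ?I" for m
    using keys_of_monomial_ideal[OF A that, of m] by auto
  show ?thesis
  proof (intro equalityI subsetI)
    fix m assume "m \<in> Gens ?I"
    then show "m \<in> A" using divisor in_I unfolding Gens_def by blast
  next
    fix m assume "m \<in> A"
    moreover have "n = m" if "monomial n \<in> ?I" "n \<subseteq># m" for n
      using divisor[OF that(1)] that(2) antichain \<open>m \<in> A\<close>
      by (metis subset_mset.antisym subset_mset.trans)
    ultimately show "m \<in> Gens ?I" using in_I unfolding Gens_def by blast
  qed
qed

section \<open>Least common multiples\<close>

lemma bdd_above_finite: "finite A \<Longrightarrow> subset_mset.bdd_above (A :: 'a multiset set)"
proof (induction A rule: finite_induct)
  case empty
  show ?case by (rule subset_mset.bdd_above.I[of _ "{#}"]) auto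
qed auto

lemma Sup_mset_le_iff:
  assumes "finite A"
  shows "Sup A \<subseteq># m \<longleftrightarrow> (\<forall>a\<in>A. a \<subseteq># m)"
proof (cases "A = {}")
  case True
  then show ?thesis by (simp add: Sup_multiset_empty)
next
  case False
  then show ?thesis by (rule subset_mset.cSup_le_iff[OF _ bdd_above_finite[OF assms]])
qed

lemma Sup_mset_upper: "finite A \<Longrightarrow> a \<in> A \<Longrightarrow> a \<subseteq># Sup A"
  using Sup_mset_le_iff by blast

lemma Sup_mset_mono: "finite B \<Longrightarrow> A \<subseteq> B \<Longrightarrow> Sup A \<subseteq># Sup B"
  by (meson Sup_mset_le_iff Sup_mset_upper finite_subset subsetD)

text \<open>
  The coefficient of the face \<open>\<sigma> - {m}\<close> in the differential is a unit exactly when \<open>m\<close> is redundant for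
  the lcm.
\<close>

lemma Sup_diff_eq_empty_iff:
  assumes "finite \<sigma>" "m \<in> \<sigma>"
  shows "Sup \<sigma> - Sup (\<sigma> - {m}) = {#} \<longleftrightarrow> m \<subseteq># Sup (\<sigma> - {m})"
  unfolding Diff_eq_empty_iff_mset Sup_mset_le_iff[OF assms(1)]
  using assms Sup_mset_upper[of "\<sigma> - {m}"] by blast

text \<open>
  Since \<open>uv\<close> is squarefree, dividing an lcm is the same as having both ends covered.
\<close>

lemma edge_dvd_Sup_iff:
  assumes "u \<noteq> v" "finite A"
  shows "{#u, v#} \<subseteq># Sup A \<longleftrightarrow> (\<exists>a\<in>A. u \<in># a) \<and> (\<exists>a\<in>A. v \<in># a)"
proof -
  have "{#u, v#} \<subseteq># M \<longleftrightarrow> u \<in># M \<and> v \<in># M" for M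
    using assms(1) by (auto simp: insert_subset_eq_iff in_diff_count)
  then show ?thesis
    by (simp add: in_Sup_multiset_iff[OF bdd_above_finite[OF assms(2)]])
qed

section \<open>Critical sets\<close>

lemma sorted_list_exists:
  assumes "finite \<sigma>" "\<sigma> \<subseteq> A" "strict_linear_order_on A r"
  obtains ms where "sorted_wrt (\<lambda>m n. (m, n) \<in> r) ms" "set ms = \<sigma>"
proof -
  from assms have tr: "trans r" and tot: "total_on A r"
    by (auto simp: strict_linear_order_on_def)
  from assms(1,2) have "\<exists>ms. sorted_wrt (\<lambda>m n. (m, n) \<in> r) ms \<and> set ms = \<sigma>"
  proof (induction \<sigma> rule: finite_induct)
    case empty
    show ?case by (intro exI[of _ "[]"]) auto
  next
    case (insert x F)
    then obtain ms where ms: "sorted_wrt (\<lambda>m n. (m, n) \<in> r) ms" "set ms = F" by auto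
    let ?ms = "filter (\<lambda>m. (m, x) \<in> r) ms @ x # filter (\<lambda>m. (x, m) \<in> r) ms"
    have "sorted_wrt (\<lambda>m n. (m, n) \<in> r) ?ms"
      using ms(1) tr by (auto simp: sorted_wrt_append sorted_wrt_filter dest: transD)
    moreover have "set ?ms = insert x F"
      using insert ms(2) tot by (auto simp: total_on_def)
    ultimately show ?case by blast
  qed
  with that show thesis by blast
qed

lemma strict_linear_order_with_last:
  fixes A :: "'a set"
  assumes "finite A"
  obtains r where "strict_linear_order_on A r" "\<And>a. a \<in> A \<Longrightarrow> a \<noteq> z \<Longrightarrow> (a, z) \<in> r"
proof -
  obtain f :: "'a \<Rightarrow> nat" and n where f: "f ` A = {i. i < n}" "inj_on f A"
    using finite_imp_inj_to_nat_seg[OF assms] by (elim exE conjE)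
  define g where "g a = (if a = z then n else f a)" for a
  define r where "r = inv_image {(i, j). i < j} g"
  have less: "f a < n" if "a \<in> A" for a using f(1) that by blast
  have "g a < g b \<or> g b < g a" if "a \<in> A" "b \<in> A" "a \<noteq> b" for a b
    using less[OF that(1)] less[OF that(2)] inj_onD[OF f(2) _ that(1,2)] that(3)
    by (cases "f a" "f b" rule: linorder_cases) (auto simp: g_def)
  then have "total_on A r" by (simp add: total_on_def r_def)
  moreover have "trans r" unfolding r_def by (rule trans_inv_image) (auto intro: transI)
  moreover have "irrefl r" by (simp add: irrefl_def r_def)
  ultimately have "strict_linear_order_on A r" by (simp add: strict_linear_order_on_def)
  moreover have "(a, z) \<in> r" if "a \<in> A" "a \<noteq> z" for a
    using less[OF that(1)] that(2) by (simp add: r_def g_def)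
  ultimately show thesis by (rule that)
qed

lemma takeWhile_eq_filter_if_sorted:
  assumes "sorted_wrt R ms" "\<And>x y. R x y \<Longrightarrow> P y \<Longrightarrow> P x"
  shows "takeWhile P ms = filter P ms"
  using assms(1)
proof (induction ms)
  case (Cons a ms)
  show ?case
  proof (cases "P a")
    case False
    then have "\<forall>b\<in>set ms. \<not> P b" using Cons.prems assms(2) by auto
    with False show ?thesis by (simp add: filter_empty_conv)
  qed (use Cons in auto)
qed simp

text \<open>
  The elements of \<open>\<sigma>\<close> that precede \<open>m\<close> form an initial segment of the sorted list of \<open>\<sigma>\<close>, and among the
  segments whose last element precedes \<open>m\<close> it is the longest, hence the one with the largest lcm. So it is
  enough to test this segment. Segments of length 0 and 1 never matter: the only monomial dividing
  \<open>Sup {} = 1\<close> is 1 itself, which is not a generator, and a minimal generator does not divide a different one.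
\<close>

lemma lyubeznik_critical_iff:
  fixes I :: "('v, 'k::field) mpoly set"
  assumes lin: "strict_linear_order_on (Gens I) r" and proper: "{#} \<notin> Gens I"
  shows "lyubeznik_critical r I \<sigma> \<longleftrightarrow>
    finite \<sigma> \<and> \<sigma> \<subseteq> Gens I \<and> (\<forall>m\<in>Gens I. \<not> m \<subseteq># Sup {q\<in>\<sigma>. (q, m) \<in> r})"
    (is "_ \<longleftrightarrow> ?R")
proof -
  from lin have tr: "trans r" and irr: "irrefl r"
    by (auto simp: strict_linear_order_on_def)
  have divides: "(\<exists>t. 1 < t \<and> t \<le> length ms \<and> (ms ! (t - 1), m) \<in> r \<and> m \<subseteq># Sup (set (take t ms)))
      \<longleftrightarrow> m \<subseteq># Sup {q\<in>\<sigma>. (q, m) \<in> r}" (is "?L \<longleftrightarrow> _")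
    if ms: "sorted_wrt (\<lambda>m n. (m, n) \<in> r) ms" "set ms = \<sigma>" and sub: "\<sigma> \<subseteq> Gens I"
      and m: "m \<in> Gens I" for ms m
  proof
    assume ?L
    then obtain t where t: "1 < t" "t \<le> length ms" "(ms ! (t - 1), m) \<in> r"
      and dvd: "m \<subseteq># Sup (set (take t ms))" by blast
    have "(ms ! i, m) \<in> r" if "i < t" for i
    proof (cases "i = t - 1")
      case False
      with that t have "(ms ! i, ms ! (t - 1)) \<in> r"
        by (intro sorted_wrt_nth_less[OF ms(1)]) auto
      with t(3) tr show ?thesis by (auto dest: transD)
    qed (use t in auto)
    then have "q \<in> {q\<in>\<sigma>. (q, m) \<in> r}" if "q \<in> set (take t ms)" for q
      using that t(2) ms(2) nth_mem[of _ ms] by (auto simp: in_set_conv_nth[of q "take t ms"])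
    moreover have "finite {q\<in>\<sigma>. (q, m) \<in> r}" using ms(2) by auto
    ultimately have "Sup (set (take t ms)) \<subseteq># Sup {q\<in>\<sigma>. (q, m) \<in> r}"
      by (intro Sup_mset_mono subsetI)
    with dvd show "m \<subseteq># Sup {q\<in>\<sigma>. (q, m) \<in> r}" by (rule subset_mset.trans)
  next
    assume dvd: "m \<subseteq># Sup {q\<in>\<sigma>. (q, m) \<in> r}"
    let ?xs = "takeWhile (\<lambda>q. (q, m) \<in> r) ms"
    define t where "t = length ?xs"
    have xs: "?xs = filter (\<lambda>q. (q, m) \<in> r) ms"
      by (rule takeWhile_eq_filter_if_sorted[OF ms(1)]) (use tr in \<open>auto dest: transD\<close>)
    then have set_xs: "set ?xs = {q\<in>\<sigma>. (q, m) \<in> r}" using ms(2) by auto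
    have take: "take t ms = ?xs" unfolding t_def by (rule takeWhile_eq_take[symmetric])
    have "t \<noteq> 0"
    proof
      assume "t = 0"
      then have "{q\<in>\<sigma>. (q, m) \<in> r} = {}" using set_xs by (simp add: t_def)
      with dvd have "m = {#}" by (simp add: Sup_multiset_empty)
      with m proper show False by simp
    qed
    moreover have "t \<noteq> 1"
    proof
      assume "t = 1"
      then obtain q where "?xs = [q]" by (auto simp: t_def length_Suc_conv)
      then have q: "{q\<in>\<sigma>. (q, m) \<in> r} = {q}" using set_xs by simp
      with dvd have "m \<subseteq># q" by simp
      moreover have "q \<in> Gens I" "(q, m) \<in> r" using q sub by auto
      ultimately show False using m irr unfolding Gens_def irrefl_def by blast
    qed
    moreover have "t \<le> length ms" unfolding t_def by (rule length_takeWhile_le)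
    moreover have "(ms ! (t - 1), m) \<in> r"
    proof -
      have "ms ! (t - 1) = ?xs ! (t - 1)"
        using \<open>t \<noteq> 0\<close> take by (metis One_nat_def diff_less lessI nth_take neq0_conv zero_less_Suc)
      also have "\<dots> \<in> set ?xs" using \<open>t \<noteq> 0\<close> unfolding t_def by (intro nth_mem) auto
      finally show ?thesis using set_xs by auto
    qed
    ultimately show ?L using dvd set_xs take by (intro exI[of _ t]) auto
  qed
  show ?thesis
  proof
    assume "lyubeznik_critical r I \<sigma>"
    then obtain ms where "\<sigma> \<subseteq> Gens I" "sorted_wrt (\<lambda>m n. (m, n) \<in> r) ms" "set ms = \<sigma>"
      and "\<forall>m\<in>Gens I. \<not> (\<exists>t. 1 < t \<and> t \<le> length ms \<and>
            (ms ! (t - 1), m) \<in> r \<and> m \<subseteq># Sup (set (take t ms)))"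
      unfolding lyubeznik_critical_def by blast
    moreover from this have "finite \<sigma>" by auto
    ultimately show ?R using divides by blast
  next
    assume R: ?R
    then obtain ms where "sorted_wrt (\<lambda>m n. (m, n) \<in> r) ms" "set ms = \<sigma>"
      using sorted_list_exists[OF _ _ lin] by blast
    with R divides show "lyubeznik_critical r I \<sigma>"
      unfolding lyubeznik_critical_def by blast
  qed
qed

text \<open>
  Critical sets form a simplicial complex, so the faces occurring in the differential are basis elements
  of the resolution.
\<close>

lemma lyubeznik_critical_subset:
  fixes I :: "('v, 'k::field) mpoly set"
  assumes lin: "strict_linear_order_on (Gens I) r" and proper: "{#} \<notin> Gens I"
    and crit: "lyubeznik_critical r I \<sigma>" and "\<tau> \<subseteq> \<sigma>"
  shows "lyubeznik_critical r I \<tau>"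
proof -
  from crit have fin: "finite \<sigma>" and sub: "\<sigma> \<subseteq> Gens I"
    and c: "\<And>m. m \<in> Gens I \<Longrightarrow> \<not> m \<subseteq># Sup {q\<in>\<sigma>. (q, m) \<in> r}"
    unfolding lyubeznik_critical_iff[OF lin proper] by blast+
  have "\<not> m \<subseteq># Sup {q\<in>\<tau>. (q, m) \<in> r}" if "m \<in> Gens I" for m
  proof -
    have "Sup {q\<in>\<tau>. (q, m) \<in> r} \<subseteq># Sup {q\<in>\<sigma>. (q, m) \<in> r}"
      by (rule Sup_mset_mono) (use fin \<open>\<tau> \<subseteq> \<sigma>\<close> in auto)
    with c[OF that] show ?thesis using subset_mset.trans by blast
  qed
  with fin sub \<open>\<tau> \<subseteq> \<sigma>\<close> show ?thesis
    unfolding lyubeznik_critical_iff[OF lin proper] by (meson finite_subset order_trans)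
qed

section \<open>Minimality as a condition on critical sets\<close>

lemma var_ideal_eq:
  "var_ideal V = Idl\<^bsub>poly_ring V\<^esub> (monomial ` ((\<lambda>v. {#v#}) ` V))"
  unfolding var_ideal_def by (rule arg_cong[where f = "genideal _"]) auto

text \<open>
  No unit lies in the ideal of the variables; this is what rules out a redundant element in
  a critical set.
\<close>

lemma constant_coeff_var_ideal:
  assumes "p \<in> var_ideal V"
  shows "Poly_Mapping.lookup p {#} = 0"
proof (rule ccontr)
  assume "Poly_Mapping.lookup p {#} \<noteq> 0"
  then have "{#} \<in> Poly_Mapping.keys p" by (simp add: in_keys_iff)
  with assms show False
    unfolding var_ideal_eq by (rule keys_of_monomial_ideal[rotated]) auto
qed

lemma single_in_var_ideal:
  assumes "m \<noteq> {#}" "set_mset m \<subseteq> V"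
  shows "Poly_Mapping.single m (c :: 'k::field) \<in> var_ideal V"
proof -
  obtain v where "v \<in># m" using assms(1) by blast
  then show ?thesis unfolding var_ideal_eq
    by (intro single_in_monomial_ideal[of _ _ "{#v#}"]) (use assms(2) in auto)
qed

lemma ideal_var_ideal: "ideal (var_ideal V :: ('v, 'k::field) mpoly set) (poly_ring V)"
proof -
  interpret cring "poly_ring V :: ('v, 'k) mpoly ring" by (rule cring_poly_ring)
  show ?thesis unfolding var_ideal_eq by (rule genideal_ideal) auto
qed

lemma coeff_ideal_times_module:
  fixes J :: "('v, 'k::field) mpoly set"
  assumes J: "ideal J (poly_ring V)" and f: "f \<in> ideal_times_module J M"
    and M: "\<And>g. g \<in> M \<Longrightarrow> Poly_Mapping.lookup g \<sigma> \<in> carrier (poly_ring V)"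
  shows "Poly_Mapping.lookup f \<sigma> \<in> J"
proof -
  interpret ideal J "poly_ring V" by (rule J)
  obtain n a g where n: "f = (\<Sum>i<(n::nat). Poly_Mapping.map (\<lambda>q. a i * q) (g i))"
    and ag: "\<And>i. i < n \<Longrightarrow> a i \<in> J \<and> g i \<in> M"
    using f unfolding ideal_times_module_def by blast
  have "Poly_Mapping.lookup f \<sigma> = (\<Sum>i<n. a i * Poly_Mapping.lookup (g i) \<sigma>)"
    unfolding n lookup_sum by (intro sum.cong) (auto simp: map.rep_eq when_def)
  also have "k \<le> n \<Longrightarrow> (\<Sum>i<k. a i * Poly_Mapping.lookup (g i) \<sigma>) \<in> J" for k
  proof (induction k)
    case 0
    show ?case using additive_subgroup.zero_closed[OF additive_subgroup_axioms] by simp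
  next
    case (Suc k)
    have "a k * Poly_Mapping.lookup (g k) \<sigma> \<in> J"
      using I_r_closed[of "a k" "Poly_Mapping.lookup (g k) \<sigma>"] ag[of k] M[of "g k"] Suc.prems by auto
    then show ?case
      using Suc additive_subgroup.a_closed[OF additive_subgroup_axioms] by simp
  qed
  finally show ?thesis by simp
qed

lemma sum_in_ideal_times_module:
  fixes J :: "('v, 'k::field) mpoly set"
  assumes "finite X" and "\<And>x. x \<in> X \<Longrightarrow> a x \<in> J \<and> g x \<in> M"
  shows "(\<Sum>x\<in>X. Poly_Mapping.map (\<lambda>q. a x * q) (g x)) \<in> ideal_times_module J M"
proof -
  obtain h where h: "bij_betw h {0..<card X} X"
    using ex_bij_betw_nat_finite[OF \<open>finite X\<close>] by blast
  have "(\<Sum>x\<in>X. Poly_Mapping.map (\<lambda>q. a x * q) (g x))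
      = (\<Sum>i<card X. Poly_Mapping.map (\<lambda>q. a (h i) * q) (g (h i)))"
    using sum.reindex_bij_betw[OF h, of "\<lambda>x. Poly_Mapping.map (\<lambda>q. a x * q) (g x)"]
    by (simp add: lessThan_atLeast0)
  moreover have "\<forall>i<card X. a (h i) \<in> J \<and> g (h i) \<in> M"
    using assms(2) bij_betwE[OF h] by simp
  ultimately show ?thesis unfolding ideal_times_module_def
    by (intro CollectI exI[of _ "card X"] exI[of _ "\<lambda>i. a (h i)"] exI[of _ "\<lambda>i. g (h i)"]) simp
qed

text \<open>
  If \<open>m\<close> is redundant in \<open>\<sigma>\<close>, the differential of the basis element \<open>\<sigma>\<close> has the coefficient \<open>1\<close> or \<open>-1\<close>
  at \<open>\<sigma> - {m}\<close>, since different elements of \<open>\<sigma>\<close> give different faces and nothing cancels. If there is no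
  such pair, every coefficient is a multiple of a monomial other than 1, hence lies in the ideal of
  the variables.
\<close>

lemma minimal_lyubeznik_resolution_iff:
  fixes I :: "('v, 'k::field) mpoly set"
  assumes lin: "strict_linear_order_on (Gens I) r" and proper: "{#} \<notin> Gens I"
    and V: "\<forall>m\<in>Gens I. set_mset m \<subseteq> V"
  shows "minimal_lyubeznik_resolution V r I \<longleftrightarrow>
    (\<forall>\<sigma> m. lyubeznik_critical r I \<sigma> \<longrightarrow> m \<in> \<sigma> \<longrightarrow> \<not> m \<subseteq># Sup (\<sigma> - {m}))"
    (is "_ \<longleftrightarrow> ?R")
proof
  assume min: "minimal_lyubeznik_resolution V r I"
  show ?R
  proof (intro allI impI notI)
    fix \<sigma> m assume crit: "lyubeznik_critical r I \<sigma>" and m: "m \<in> \<sigma>" and dvd: "m \<subseteq># Sup (\<sigma> - {m})"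
    from crit have fin: "finite \<sigma>" unfolding lyubeznik_critical_iff[OF lin proper] by blast
    then obtain i where i: "card \<sigma> = Suc i" using m by (metis card_Suc_Diff1)
    let ?f = "Poly_Mapping.single \<sigma> (1 :: ('v, 'k) mpoly)"
    let ?s = "\<lambda>n. (- 1 :: 'k) ^ card {q\<in>\<sigma>. (q, n) \<in> r}"
    have "?f \<in> lyubeznik_module V r I (Suc i)"
      using crit i by (auto simp: lyubeznik_module_def)
    then have "taylor_differential r ?f
        \<in> ideal_times_module (var_ideal V) (lyubeznik_module V r I i)"
      using min unfolding minimal_lyubeznik_resolution_def by blast
    then have "Poly_Mapping.lookup (taylor_differential r ?f) (\<sigma> - {m}) \<in> var_ideal V"
    proof (rule coeff_ideal_times_module[OF ideal_var_ideal])
      fix g :: "'v multiset set \<Rightarrow>\<^sub>0 ('v, 'k) mpoly"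
      assume "g \<in> lyubeznik_module V r I i"
      then show "Poly_Mapping.lookup g (\<sigma> - {m}) \<in> carrier (poly_ring V)"
        by (cases "\<sigma> - {m} \<in> Poly_Mapping.keys g") (auto simp: lyubeznik_module_def in_keys_iff)
    qed
    also have "Poly_Mapping.lookup (taylor_differential r ?f) (\<sigma> - {m})
        = (\<Sum>n\<in>\<sigma>. if n = m then Poly_Mapping.single {#} (?s m) else 0)"
    proof -
      have "Poly_Mapping.lookup (Poly_Mapping.single (\<sigma> - {n})
            (Poly_Mapping.single (Sup \<sigma> - Sup (\<sigma> - {n})) (?s n))) (\<sigma> - {m})
          = (if n = m then Poly_Mapping.single {#} (?s m) else 0)" if "n \<in> \<sigma>" for n
      proof (cases "n = m")
        case True
        then show ?thesis using Sup_diff_eq_empty_iff[OF fin m] dvd by simp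
      next
        case False
        then have "\<sigma> - {n} \<noteq> \<sigma> - {m}" using m that by blast
        with False show ?thesis by (simp add: lookup_single_not_eq)
      qed
      then show ?thesis by (simp add: taylor_differential_def lookup_sum)
    qed
    also have "\<dots> = Poly_Mapping.single {#} (?s m)" using fin m by simp
    finally have "?s m = 0" by (auto dest: constant_coeff_var_ideal)
    then show False by simp
  qed
next
  assume R: ?R
  show "minimal_lyubeznik_resolution V r I"
    unfolding minimal_lyubeznik_resolution_def
  proof (intro allI subsetI, elim imageE, clarify)
    fix i f assume f: "f \<in> lyubeznik_module V r I (Suc i)"
    interpret ideal "var_ideal V :: ('v, 'k) mpoly set" "poly_ring V" by (rule ideal_var_ideal)
    let ?P = "SIGMA \<sigma>:Poly_Mapping.keys f. \<sigma>"
    define q :: "'v multiset set \<times> 'v multiset \<Rightarrow> ('v, 'k) mpoly" where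
      "q = (\<lambda>(\<sigma>, m). Poly_Mapping.lookup f \<sigma> *
          Poly_Mapping.single (Sup \<sigma> - Sup (\<sigma> - {m})) ((- 1) ^ card {n\<in>\<sigma>. (n, m) \<in> r}))"
    define e :: "'v multiset set \<times> 'v multiset \<Rightarrow> 'v multiset set \<Rightarrow>\<^sub>0 ('v, 'k) mpoly" where
      "e = (\<lambda>(\<sigma>, m). Poly_Mapping.single (\<sigma> - {m}) 1)"
    have crit: "lyubeznik_critical r I \<sigma>" "card \<sigma> = Suc i"
        "Poly_Mapping.lookup f \<sigma> \<in> carrier (poly_ring V)" if "\<sigma> \<in> Poly_Mapping.keys f" for \<sigma>
      using f that by (auto simp: lyubeznik_module_def)
    have fin: "finite \<sigma>" and sub: "\<sigma> \<subseteq> Gens I" if "\<sigma> \<in> Poly_Mapping.keys f" for \<sigma>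
      using crit(1)[OF that] unfolding lyubeznik_critical_iff[OF lin proper] by blast+
    have "taylor_differential r f = (\<Sum>x\<in>?P. Poly_Mapping.map (\<lambda>p. q x * p) (e x))"
      unfolding taylor_differential_def
      by (subst sum.Sigma) (auto simp: fin q_def e_def intro!: sum.cong)
    also have "\<dots> \<in> ideal_times_module (var_ideal V) (lyubeznik_module V r I i)"
    proof (rule sum_in_ideal_times_module)
      show "finite ?P" using fin by (intro finite_SigmaI) auto
      fix x assume "x \<in> ?P"
      then obtain \<sigma> m where x: "x = (\<sigma>, m)" and \<sigma>: "\<sigma> \<in> Poly_Mapping.keys f" and m: "m \<in> \<sigma>" by blast
      let ?d = "Sup \<sigma> - Sup (\<sigma> - {m})"
      have "?d \<noteq> {#}"
        using Sup_diff_eq_empty_iff[OF fin[OF \<sigma>] m] R crit(1)[OF \<sigma>] m by blast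
      moreover have "set_mset (Sup \<sigma>) \<subseteq> V"
        unfolding set_mset_Sup[OF bdd_above_finite[OF fin[OF \<sigma>]]] using sub[OF \<sigma>] V by blast
      then have "set_mset ?d \<subseteq> V" by (auto dest: in_diffD)
      ultimately have "Poly_Mapping.single ?d c \<in> var_ideal V" for c :: 'k
        by (rule single_in_var_ideal)
      then have "q x \<in> var_ideal V"
        unfolding x q_def using I_l_closed crit(3)[OF \<sigma>] by simp
      moreover have "lyubeznik_critical r I (\<sigma> - {m})"
        by (rule lyubeznik_critical_subset[OF lin proper crit(1)[OF \<sigma>]]) auto
      then have "e x \<in> lyubeznik_module V r I i"
        unfolding x e_def lyubeznik_module_def using crit(2)[OF \<sigma>] m fin[OF \<sigma>] by auto
      ultimately show "q x \<in> var_ideal V \<and> e x \<in> lyubeznik_module V r I i" by blast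
    qed
    finally show "taylor_differential r f
        \<in> ideal_times_module (var_ideal V) (lyubeznik_module V r I i)" .
  qed
qed

section \<open>Edge ideals\<close>

definition edges :: "'v pair_pre_digraph \<Rightarrow> 'v multiset set" where
  "edges G = {{#u, v#} | u v. (u, v) \<in> parcs G}"

text \<open>
  The two ends of \<open>xy\<close> form a vertex cover; this is the property that singles out the graphs \<open>L(a, b, c)\<close>
  among the connected ones.
\<close>

definition covering_edge :: "'v pair_pre_digraph \<Rightarrow> 'v \<Rightarrow> 'v \<Rightarrow> bool" where
  "covering_edge G x y \<longleftrightarrow>
    (x, y) \<in> parcs G \<and> (\<forall>(u, v)\<in>parcs G. u \<in> {x, y} \<or> v \<in> {x, y})"

context pair_graph
begin

lemma arc_sym: "(u, v) \<in> parcs G \<Longrightarrow> (v, u) \<in> parcs G"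
  using pair_sym_arcs by (auto simp: symmetric_def dest: symD)

lemma arc_neq: "(u, v) \<in> parcs G \<Longrightarrow> u \<noteq> v"
  using pair_no_loops by fastforce

lemma in_edges_iff [simp]: "{#u, v#} \<in> edges G \<longleftrightarrow> (u, v) \<in> parcs G"
proof
  assume "{#u, v#} \<in> edges G"
  then obtain u' v' where "(u', v') \<in> parcs G" "{#u, v#} = {#u', v'#}"
    by (auto simp: edges_def)
  then show "(u, v) \<in> parcs G"
    using arc_sym[of u' v'] by (auto simp: add_eq_conv_ex)
qed (auto simp: edges_def)

lemma finite_edges: "finite (edges G)"
proof -
  have "edges G = (\<lambda>(u, v). {#u, v#}) ` parcs G" by (auto simp: edges_def)
  then show ?thesis using pair_finite_arcs by simp
qed

lemma Gens_edge_ideal: "Gens (edge_ideal G :: ('a, 'k::field) mpoly set) = edges G"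
proof -
  have "edge_ideal G
      = (Idl\<^bsub>poly_ring (pverts G)\<^esub> (monomial ` edges G) :: ('a, 'k) mpoly set)"
    unfolding edge_ideal_def edges_def by (rule arg_cong[where f = "genideal _"]) auto
  also have "Gens \<dots> = edges G"
  proof (rule Gens_monomial_ideal)
    fix a assume "a \<in> edges G"
    then show "set_mset a \<subseteq> pverts G"
      by (auto simp: edges_def dest: in_arcsD1 in_arcsD2)
  next
    fix a b assume "a \<in> edges G" "b \<in> edges G" "a \<subseteq># b"
    moreover from this have "size a = size b" by (auto simp: edges_def)
    ultimately show "a = b" by (metis less_irrefl mset_subset_size subset_mset.le_neq_trans)
  qed
  finally show ?thesis .
qed

text \<open>
  This removes the algebra, and with it the field: what remains is a question about orders on the edges.
\<close>

lemma lyubeznik_edge_ideal_iff: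
  "lyubeznik_ideal (pverts G) (edge_ideal G :: ('a, 'k::field) mpoly set) \<longleftrightarrow>
    (\<exists>r. strict_linear_order_on (edges G) r \<and>
      (\<forall>\<sigma> m. \<sigma> \<subseteq> edges G \<longrightarrow> (\<forall>e\<in>edges G. \<not> e \<subseteq># Sup {q\<in>\<sigma>. (q, e) \<in> r}) \<longrightarrow>
        m \<in> \<sigma> \<longrightarrow> \<not> m \<subseteq># Sup (\<sigma> - {m})))"
proof -
  let ?I = "edge_ideal G :: ('a, 'k) mpoly set"
  have proper: "{#} \<notin> Gens ?I" unfolding Gens_edge_ideal by (auto simp: edges_def)
  have V: "\<forall>m\<in>Gens ?I. set_mset m \<subseteq> pverts G"
    unfolding Gens_edge_ideal
    by (auto simp: edges_def dest: in_arcsD1 in_arcsD2)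
  have fin: "finite \<sigma> \<and> \<sigma> \<subseteq> edges G \<and> P \<longleftrightarrow> \<sigma> \<subseteq> edges G \<and> P" for \<sigma> P
    using finite_subset[OF _ finite_edges] by blast
  have key: "minimal_lyubeznik_resolution (pverts G) r ?I \<longleftrightarrow>
      (\<forall>\<sigma> m. \<sigma> \<subseteq> edges G \<longrightarrow> (\<forall>e\<in>edges G. \<not> e \<subseteq># Sup {q\<in>\<sigma>. (q, e) \<in> r}) \<longrightarrow>
        m \<in> \<sigma> \<longrightarrow> \<not> m \<subseteq># Sup (\<sigma> - {m}))"
    if "strict_linear_order_on (edges G) r" for r
  proof -
    have lin: "strict_linear_order_on (Gens ?I) r" using that by (simp only: Gens_edge_ideal)
    show ?thesis
      unfolding minimal_lyubeznik_resolution_iff[OF lin proper V]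
        lyubeznik_critical_iff[OF lin proper] Gens_edge_ideal fin
      by (simp only: imp_conjL)
  qed
  show ?thesis
    unfolding lyubeznik_ideal_def Gens_edge_ideal by (intro ex_cong1 conj_cong refl key)
qed

section \<open>The last edge of an order with minimal resolution\<close>

text \<open>
  The middle edge of the path \<open>x y c d\<close> is covered by the outer ones, so the three edges are not a
  critical set: some edge \<open>e\<close> is covered by those edges of the path that precede it. The last edge \<open>xy\<close>
  is not among them, so \<open>e\<close> lies in the triangle on \<open>y\<close>, \<open>c\<close>, \<open>d\<close>. The edges \<open>yc\<close> and \<open>cd\<close> do not precede
  themselves and each has an end that the other misses, which leaves \<open>e = yd\<close>; its end \<open>y\<close> can only be
  covered by \<open>yc\<close>.
\<close>

lemma path_from_last_edge:
  assumes lin: "strict_linear_order_on (edges G) r"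
    and min: "\<And>\<sigma> m. \<lbrakk>\<sigma> \<subseteq> edges G; \<forall>e\<in>edges G. \<not> e \<subseteq># Sup {q\<in>\<sigma>. (q, e) \<in> r}; m \<in> \<sigma>\<rbrakk>
        \<Longrightarrow> \<not> m \<subseteq># Sup (\<sigma> - {m})"
    and last: "\<And>e. e \<in> edges G \<Longrightarrow> e \<noteq> {#x, y#} \<Longrightarrow> (e, {#x, y#}) \<in> r"
    and arcs: "(x, y) \<in> parcs G" "(y, c) \<in> parcs G" "(c, d) \<in> parcs G"
    and out: "c \<noteq> x" "d \<noteq> x" "d \<noteq> y"
  shows "(y, d) \<in> parcs G \<and> ({#y, c#}, {#y, d#}) \<in> r"
proof -
  from lin have tr: "trans r" and irr: "irrefl r"
    by (auto simp: strict_linear_order_on_def)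
  have neq: "x \<noteq> y" "y \<noteq> c" "c \<noteq> d" using arcs by (auto dest: arc_neq)
  let ?\<sigma> = "{{#x, y#}, {#y, c#}, {#c, d#}}"
  have sub: "?\<sigma> \<subseteq> edges G" using arcs by simp
  have dvd: "{#y, c#} \<subseteq># Sup (?\<sigma> - {{#y, c#}})"
  proof -
    have "{#x, y#} \<noteq> {#y, c#}" "{#c, d#} \<noteq> {#y, c#}"
      using neq out by (auto simp: add_eq_conv_ex)
    then have "?\<sigma> - {{#y, c#}} = {{#x, y#}, {#c, d#}}" by auto
    then show ?thesis using neq(2) by (simp add: edge_dvd_Sup_iff)
  qed
  have "\<exists>e\<in>edges G. e \<subseteq># Sup {q\<in>?\<sigma>. (q, e) \<in> r}"
  proof (rule ccontr)
    assume "\<not> ?thesis"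
    then have "\<forall>e\<in>edges G. \<not> e \<subseteq># Sup {q\<in>?\<sigma>. (q, e) \<in> r}" by blast
    from min[OF sub this, of "{#y, c#}"] dvd show False by simp
  qed
  then obtain e where e: "e \<in> edges G" "e \<subseteq># Sup {q\<in>?\<sigma>. (q, e) \<in> r}" ..
  then obtain u v where uv: "e = {#u, v#}" "(u, v) \<in> parcs G" "u \<noteq> v"
    by (auto simp: edges_def dest: arc_neq)
  have not_last: "({#x, y#}, e) \<notin> r"
    using last[OF e(1)] tr irr by (metis irrefl_def transD)
  have cover: "\<exists>q\<in>{{#y, c#}, {#c, d#}}. (q, e) \<in> r \<and> w \<in># q" if "w \<in> {u, v}" for w
  proof -
    have "finite {q\<in>?\<sigma>. (q, e) \<in> r}" by simp
    then have "\<exists>q\<in>{q\<in>?\<sigma>. (q, e) \<in> r}. w \<in># q"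
      using e(2) that edge_dvd_Sup_iff[OF uv(3)] unfolding uv(1) by blast
    then show ?thesis using not_last by blast
  qed
  \<comment> \<open>\<open>e\<close> is now one of the three edges of the triangle, and two of them are excluded.\<close>
  have "u \<in> {y, c, d}" "v \<in> {y, c, d}" using cover[of u] cover[of v] by auto
  moreover have "e \<noteq> {#y, c#}"
  proof
    assume *: "e = {#y, c#}"
    then have "y \<in> {u, v}" using uv(1) by (auto simp: add_eq_conv_ex)
    with cover[of y] irr * neq out show False by (auto simp: irrefl_def)
  qed
  moreover have "e \<noteq> {#c, d#}"
  proof
    assume *: "e = {#c, d#}"
    then have "d \<in> {u, v}" using uv(1) by (auto simp: add_eq_conv_ex)
    with cover[of d] irr * neq out show False by (auto simp: irrefl_def)
  qed
  ultimately have e_eq: "e = {#y, d#}" and "y \<in> {u, v}"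
    using uv(1,3) by (auto simp: add_mset_commute)
  with cover[of y] neq out have "({#y, c#}, {#y, d#}) \<in> r" by auto
  with e(1) e_eq show ?thesis by simp
qed

lemma connected_closed_superset:
  assumes conn: "Digraph_Component.connected (with_proj G)"
    and u: "u \<in> pverts G" "u \<in> S"
    and closed: "\<And>v w. v \<in> S \<Longrightarrow> (v, w) \<in> parcs G \<Longrightarrow> w \<in> S"
  shows "pverts G \<subseteq> S"
proof
  fix w assume w: "w \<in> pverts G"
  have arcs: "parcs (mk_symmetric (with_proj G)) \<subseteq> parcs G"
    by (auto simp: mk_symmetric_def intro: arc_sym)
  have "(u, w) \<in> rtrancl_on (pverts G) (parcs (mk_symmetric (with_proj G)))"
    using conn u w unfolding connected_def strongly_connected_def reachable_def
    by (auto simp: mk_symmetric_def)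
  then show "w \<in> S"
    by (induction rule: rtrancl_on_induct) (use u arcs closed in blast)+
qed

text \<open>
  Exchanging \<open>c\<close> and \<open>d\<close> in lemma \<open>path_from_last_edge\<close> gives contradictory orders of \<open>yc\<close> and \<open>yd\<close>, so
  no path with two further vertices starts with the last edge. An edge disjoint from the last edge would,
  by connectedness, produce such a path.
\<close>

lemma last_edge_covering:
  assumes conn: "Digraph_Component.connected (with_proj G)"
    and lin: "strict_linear_order_on (edges G) r"
    and min: "\<And>\<sigma> m. \<lbrakk>\<sigma> \<subseteq> edges G; \<forall>e\<in>edges G. \<not> e \<subseteq># Sup {q\<in>\<sigma>. (q, e) \<in> r}; m \<in> \<sigma>\<rbrakk>
        \<Longrightarrow> \<not> m \<subseteq># Sup (\<sigma> - {m})"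
    and last: "\<And>e. e \<in> edges G \<Longrightarrow> e \<noteq> {#x, y#} \<Longrightarrow> (e, {#x, y#}) \<in> r"
    and xy: "(x, y) \<in> parcs G"
  shows "covering_edge G x y"
proof (rule ccontr)
  assume "\<not> covering_edge G x y"
  then obtain u v where uv: "(u, v) \<in> parcs G" "u \<notin> {x, y}" "v \<notin> {x, y}"
    using xy unfolding covering_edge_def by blast
  have no_path: False
    if "(x', y') \<in> parcs G" "{#x', y'#} = {#x, y#}" "(y', c) \<in> parcs G" "(c, d) \<in> parcs G"
      "c \<notin> {x', y'}" "d \<notin> {x', y'}" for x' y' c d
  proof -
    have last': "(e, {#x', y'#}) \<in> r" if "e \<in> edges G" "e \<noteq> {#x', y'#}" for e
      using last that \<open>{#x', y'#} = {#x, y#}\<close> by simp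
    have "(y', d) \<in> parcs G" "({#y', c#}, {#y', d#}) \<in> r"
      using path_from_last_edge[OF lin min last', of c d] that by auto
    moreover from this have "({#y', d#}, {#y', c#}) \<in> r"
      using path_from_last_edge[OF lin min last', of d c] that arc_sym[of c d] by auto
    ultimately show False
      using lin by (auto simp: strict_linear_order_on_def irrefl_def dest: transD)
  qed
  \<comment> \<open>The vertices lying on an edge disjoint from \<open>xy\<close>. A neighbour in \<open>{x, y}\<close> of such a vertex would
      complete a forbidden path, so the set is closed under adjacency and, if nonempty, contains \<open>x\<close>.\<close>
  define S where "S = {c. c \<notin> {x, y} \<and> (\<exists>d. d \<notin> {x, y} \<and> (c, d) \<in> parcs G)}"
  have closed: "w \<in> S" if "c \<in> S" "(c, w) \<in> parcs G" for c w
  proof -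
    obtain d where d: "d \<notin> {x, y}" "(c, d) \<in> parcs G" using \<open>c \<in> S\<close> by (auto simp: S_def)
    have "w \<notin> {x, y}"
      using no_path[of x y c d] no_path[of y x c d] that d xy arc_sym[OF xy] arc_sym[OF that(2)]
      by (auto simp: S_def add_mset_commute)
    then show ?thesis using that arc_sym[OF that(2)] by (auto simp: S_def)
  qed
  have "u \<in> S" using uv by (auto simp: S_def)
  then have "pverts G \<subseteq> S"
    using closed by (rule connected_closed_superset[OF conn in_arcsD1[OF uv(1)]])
  moreover have "x \<in> pverts G" using xy by (rule in_arcsD1)
  ultimately show False by (auto simp: S_def)
qed

text \<open>
  If \<open>m = pv\<close> with \<open>p\<close> in \<open>{x, y}\<close> and \<open>v\<close> outside, then another edge of \<open>\<sigma>\<close> covers \<open>v\<close>, and it can only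
  join \<open>v\<close> to the element of \<open>{x, y}\<close> different from \<open>p\<close>. So \<open>m\<close> and this edge cover \<open>x\<close> and \<open>y\<close> without
  the help of \<open>xy\<close>. If \<open>m\<close> is \<open>xy\<close> itself, the redundancy of \<open>m\<close> says just that. With \<open>xy\<close> listed last,
  the conclusion is that \<open>\<sigma>\<close> is not critical.
\<close>

lemma covering_edge_dvd_if_redundant:
  assumes cov: "covering_edge G x y"
    and last: "\<And>e. e \<in> edges G \<Longrightarrow> e \<noteq> {#x, y#} \<Longrightarrow> (e, {#x, y#}) \<in> r"
    and \<sigma>: "\<sigma> \<subseteq> edges G" and m: "m \<in> \<sigma>" and dvd: "m \<subseteq># Sup (\<sigma> - {m})"
  shows "{#x, y#} \<subseteq># Sup {q\<in>\<sigma>. (q, {#x, y#}) \<in> r}"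
proof -
  have xy: "(x, y) \<in> parcs G" using cov by (simp add: covering_edge_def)
  have fin: "finite \<sigma>" using \<sigma> finite_edges by (rule finite_subset)
  have before: "(q, {#x, y#}) \<in> r" if "q \<in> \<sigma>" "q \<noteq> {#x, y#}" for q
    using last that \<sigma> by blast
  have form: "\<exists>p v. e = {#p, v#} \<and> p \<in> {x, y} \<and> v \<notin> {x, y} \<and> (p, v) \<in> parcs G"
    if "e \<in> edges G" "e \<noteq> {#x, y#}" for e
  proof -
    obtain u v where uv: "e = {#u, v#}" "(u, v) \<in> parcs G"
      using \<open>e \<in> edges G\<close> by (auto simp: edges_def)
    have "u \<in> {x, y} \<or> v \<in> {x, y}"
      using cov uv(2) unfolding covering_edge_def by blast
    moreover have "\<not> (u \<in> {x, y} \<and> v \<in> {x, y})"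
      using that(2) uv(1) arc_neq[OF uv(2)] by (auto simp: add_mset_commute)
    moreover have "e = {#v, u#}" using uv(1) by (simp add: add_mset_commute)
    ultimately show ?thesis using uv arc_sym[OF uv(2)] by blast
  qed
  have "\<exists>q\<in>\<sigma>. q \<noteq> {#x, y#} \<and> w \<in># q" if w: "w \<in> {x, y}" for w
  proof (cases "m = {#x, y#}")
    case True
    with dvd have "{#x, y#} \<subseteq># Sup (\<sigma> - {m})" by simp
    then show ?thesis using w True fin arc_neq[OF xy] by (subst (asm) edge_dvd_Sup_iff) auto
  next
    case False
    obtain p v where p: "m = {#p, v#}" "p \<in> {x, y}" "v \<notin> {x, y}" "(p, v) \<in> parcs G"
      using form[OF _ False] m \<sigma> by blast
    have "\<exists>q\<in>\<sigma> - {m}. v \<in># q"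
      using dvd fin arc_neq[OF p(4)] unfolding p(1) by (subst (asm) edge_dvd_Sup_iff) auto
    then obtain q where q: "q \<in> \<sigma>" "q \<noteq> m" "v \<in># q" by blast
    have "q \<noteq> {#x, y#}" using q(3) p(3) by auto
    then obtain p' v' where p': "q = {#p', v'#}" "p' \<in> {x, y}"
      using form[of q] q(1) \<sigma> by blast
    then have "v' = v" using q(3) p(3) by auto
    note p' = p'[unfolded this]
    have "p' \<noteq> p" using q(2) p(1) p'(1) by auto
    then have "w = p \<or> w = p'" using w p(2) p'(2) by auto
    then show ?thesis using False \<open>q \<noteq> {#x, y#}\<close> m q(1) p(1) p'(1) by auto
  qed
  then show ?thesis
    using before fin arc_neq[OF xy] by (subst edge_dvd_Sup_iff) auto
qed

lemma lyubeznik_edge_ideal_iff_covering_edge: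
  assumes conn: "Digraph_Component.connected (with_proj G)" and ne: "parcs G \<noteq> {}"
  shows "lyubeznik_ideal (pverts G) (edge_ideal G :: ('a, 'k::field) mpoly set) \<longleftrightarrow>
    (\<exists>x y. covering_edge G x y)"
proof
  assume "lyubeznik_ideal (pverts G) (edge_ideal G :: ('a, 'k) mpoly set)"
  then obtain r where lin: "strict_linear_order_on (edges G) r"
    and min: "\<And>\<sigma> m. \<lbrakk>\<sigma> \<subseteq> edges G; \<forall>e\<in>edges G. \<not> e \<subseteq># Sup {q\<in>\<sigma>. (q, e) \<in> r}; m \<in> \<sigma>\<rbrakk>
        \<Longrightarrow> \<not> m \<subseteq># Sup (\<sigma> - {m})"
    unfolding lyubeznik_edge_ideal_iff by blast
  obtain es where es: "sorted_wrt (\<lambda>m n. (m, n) \<in> r) es" "set es = edges G"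
    using sorted_list_exists[OF finite_edges order_refl lin] .
  have "edges G \<noteq> {}" using ne by (auto simp: edges_def)
  then obtain es' l where es': "es = es' @ [l]" using es(2) by (cases es rule: rev_cases) auto
  then have "l \<in> edges G" using es(2) by auto
  then obtain x y where xy: "l = {#x, y#}" "(x, y) \<in> parcs G" by (auto simp: edges_def)
  have "(e, {#x, y#}) \<in> r" if "e \<in> edges G" "e \<noteq> {#x, y#}" for e
    using es that unfolding es' xy(1) by (auto simp: sorted_wrt_append)
  then have "covering_edge G x y"
    by (intro last_edge_covering[OF conn lin min]) (use xy in auto)
  then show "\<exists>x y. covering_edge G x y" by blast
next
  assume "\<exists>x y. covering_edge G x y"
  then obtain x y where cov: "covering_edge G x y" by blast
  obtain r where lin: "strict_linear_order_on (edges G) r"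
    and last: "\<And>e. e \<in> edges G \<Longrightarrow> e \<noteq> {#x, y#} \<Longrightarrow> (e, {#x, y#}) \<in> r"
    using strict_linear_order_with_last[OF finite_edges] by blast
  have xy: "{#x, y#} \<in> edges G" using cov by (simp add: covering_edge_def)
  show "lyubeznik_ideal (pverts G) (edge_ideal G :: ('a, 'k) mpoly set)"
    unfolding lyubeznik_edge_ideal_iff
  proof (intro exI[of _ r] conjI allI impI notI)
    show "strict_linear_order_on (edges G) r" by (rule lin)
    fix \<sigma> m assume crit: "\<forall>e\<in>edges G. \<not> e \<subseteq># Sup {q\<in>\<sigma>. (q, e) \<in> r}"
      and \<sigma>: "\<sigma> \<subseteq> edges G" "m \<in> \<sigma>" "m \<subseteq># Sup (\<sigma> - {m})"
    have "{#x, y#} \<subseteq># Sup {q\<in>\<sigma>. (q, {#x, y#}) \<in> r}"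
      using covering_edge_dvd_if_redundant[OF cov last \<sigma>] .
    with bspec[OF crit xy] show False by (rule notE)
  qed
qed

end

section \<open>Graphs with a covering edge\<close>

text \<open>
  An arc of a pair digraph is determined by its ends, so the action of an isomorphism on arcs is
  determined by its action on vertices.
\<close>

lemma digraph_iso_with_proj_iff:
  assumes "wf_digraph (with_proj G)"
  shows "digraph_iso (with_proj G) (with_proj H) \<longleftrightarrow>
    (\<exists>\<phi>. inj_on \<phi> (pverts G) \<and> pverts H = \<phi> ` pverts G \<and>
      parcs H = map_prod \<phi> \<phi> ` parcs G)" (is "?L \<longleftrightarrow> ?R")
proof
  assume ?L
  then obtain f where f: "pre_digraph.digraph_isomorphism (with_proj G) f"
    and H: "with_proj H = app_iso f (with_proj G)"
    unfolding digraph_iso_def by (elim exE conjE)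
  have proj: "iso_tail f = fst" "iso_head f = snd" "pverts H = iso_verts f ` pverts G"
      "parcs H = iso_arcs f ` parcs G"
    using arg_cong[OF H, of tail] arg_cong[OF H, of head] arg_cong[OF H, of verts]
      arg_cong[OF H, of arcs] by simp_all
  have "iso_arcs f a = map_prod (iso_verts f) (iso_verts f) a" if "a \<in> parcs G" for a
    using f that unfolding pre_digraph.digraph_isomorphism_def proj
    by (simp add: prod_eq_iff)
  then have "parcs H = map_prod (iso_verts f) (iso_verts f) ` parcs G"
    unfolding proj by (rule image_cong[OF refl])
  then show ?R
    using f proj(3) unfolding pre_digraph.digraph_isomorphism_def
    by (intro exI[of _ "iso_verts f"] conjI) simp_all
next
  assume ?R
  then obtain \<phi> where \<phi>: "inj_on \<phi> (pverts G)" "pverts H = \<phi> ` pverts G"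
    "parcs H = map_prod \<phi> \<phi> ` parcs G" by (elim exE conjE)
  let ?f = "\<lparr>iso_verts = \<phi>, iso_arcs = map_prod \<phi> \<phi>, iso_head = snd, iso_tail = fst\<rparr>"
  have "parcs G \<subseteq> pverts G \<times> pverts G"
    using wf_digraph.tail_in_verts[OF assms] wf_digraph.head_in_verts[OF assms] by fastforce
  then have "inj_on (map_prod \<phi> \<phi>) (parcs G)"
    using map_prod_inj_on[OF \<phi>(1) \<phi>(1)] by (rule inj_on_subset[rotated])
  then have "pre_digraph.digraph_isomorphism (with_proj G) ?f"
    using assms \<phi>(1) by (simp add: pre_digraph.digraph_isomorphism_def)
  moreover have "with_proj H = app_iso ?f (with_proj G)"
    using \<phi>(2,3) by (simp add: app_iso_def with_proj_def)
  ultimately show ?L unfolding digraph_iso_def by (intro exI[of _ ?f] conjI)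
qed

lemma pverts_L_graph:
  "pverts (L_graph a b c) = {LX, LY} \<union> LXi ` {1..a} \<union> LYj ` {1..b} \<union> LZk ` {1..c}"
  by (simp add: L_graph_def Let_def)

lemma parcs_L_graph:
  "parcs (L_graph a b c) =
    (let E = {(LX, LY)} \<union> {LX} \<times> (LXi ` {1..a} \<union> LZk ` {1..c})
           \<union> {LY} \<times> (LYj ` {1..b} \<union> LZk ` {1..c})
     in E \<union> E\<inverse>)"
  unfolding L_graph_def Let_def by auto

lemma covering_edge_L_graph: "covering_edge (L_graph a b c) LX LY"
  unfolding covering_edge_def parcs_L_graph Let_def by auto

context pair_graph
begin

lemma covering_edge_if_iso:
  assumes "digraph_iso (with_proj G) (with_proj H)" and cov: "covering_edge H p q"
  shows "\<exists>x y. covering_edge G x y"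
proof -
  have wf: "wf_digraph (with_proj G)" by unfold_locales
  obtain \<phi> where \<phi>: "inj_on \<phi> (pverts G)" "parcs H = map_prod \<phi> \<phi> ` parcs G"
    using assms(1) unfolding digraph_iso_with_proj_iff[OF wf] by blast
  from cov obtain x y where xy: "(x, y) \<in> parcs G" "\<phi> x = p" "\<phi> y = q"
    unfolding covering_edge_def \<phi>(2) by auto
  have "u \<in> {x, y} \<or> v \<in> {x, y}" if "(u, v) \<in> parcs G" for u v
  proof -
    have "(\<phi> u, \<phi> v) \<in> parcs H" using that unfolding \<phi>(2) by force
    then have "\<phi> u \<in> {\<phi> x, \<phi> y} \<or> \<phi> v \<in> {\<phi> x, \<phi> y}"
      using cov xy(2,3) unfolding covering_edge_def by blast
    then show ?thesis
      using \<phi>(1) that xy(1) in_arcsD1 in_arcsD2 by (auto dest: inj_onD)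
  qed
  with xy(1) show ?thesis unfolding covering_edge_def by blast
qed

text \<open>
  The vertices other than \<open>x\<close> and \<open>y\<close> split into the set \<open>A\<close> of neighbours of \<open>x\<close> only, the set \<open>B\<close> of
  neighbours of \<open>y\<close> only, and the set \<open>C\<close> of common neighbours: by connectedness there are no isolated
  vertices, and the covering property leaves no further edges. Numbering the three sets gives the
  isomorphism.
\<close>

lemma iso_L_graph_if_covering_edge:
  assumes conn: "Digraph_Component.connected (with_proj G)" and cov: "covering_edge G x y"
  shows "\<exists>a b c. digraph_iso (with_proj G) (with_proj (L_graph a b c))"
proof -
  have wf: "wf_digraph (with_proj G)" by unfold_locales
  have xy: "(x, y) \<in> parcs G" and cover: "\<And>u v. (u, v) \<in> parcs G \<Longrightarrow> u \<in> {x, y} \<or> v \<in> {x, y}"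
    using cov unfolding covering_edge_def by blast+
  have neq: "x \<noteq> y" using xy by (rule arc_neq)
  define A where "A = {v \<in> pverts G - {x, y}. (x, v) \<in> parcs G \<and> (y, v) \<notin> parcs G}"
  define B where "B = {v \<in> pverts G - {x, y}. (x, v) \<notin> parcs G \<and> (y, v) \<in> parcs G}"
  define C where "C = {v \<in> pverts G - {x, y}. (x, v) \<in> parcs G \<and> (y, v) \<in> parcs G}"
  note defs = A_def B_def C_def
  have "pverts G \<subseteq> {x, y} \<union> {v. (x, v) \<in> parcs G \<or> (y, v) \<in> parcs G}"
  proof (rule connected_closed_superset[OF conn, of x])
    show "x \<in> pverts G" using xy by (rule in_arcsD1)
    fix v w assume "(v, w) \<in> parcs G"
    then show "w \<in> {x, y} \<union> {v. (x, v) \<in> parcs G \<or> (y, v) \<in> parcs G}"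
      using cover[of v w] by auto
  qed auto
  then have verts: "pverts G = {x, y} \<union> A \<union> B \<union> C"
    using in_arcsD1[OF xy] in_arcsD2[OF xy] unfolding defs by blast
  have arcs: "parcs G = (let E = {(x, y)} \<union> {x} \<times> (A \<union> C) \<union> {y} \<times> (B \<union> C) in E \<union> E\<inverse>)"
    (is "_ = ?E")
  proof (intro equalityI subsetI)
    fix e assume "e \<in> parcs G"
    moreover obtain u v where "e = (u, v)" by fastforce
    ultimately show "e \<in> ?E"
      using cover[of u v] arc_neq[of u v] arc_sym[of u v] in_arcsD1[of u v] in_arcsD2[of u v]
      unfolding Let_def defs by auto
  next
    fix e assume "e \<in> ?E"
    then show "e \<in> parcs G" using xy unfolding Let_def defs by (auto intro: arc_sym)
  qed
  have fin: "finite A" "finite B" "finite C"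
    using pair_finite_verts unfolding defs by simp_all
  obtain f where f: "bij_betw f A {1..card A}"
    using finite_same_card_bij[OF fin(1), of "{1..card A}"] by auto
  obtain g where g: "bij_betw g B {1..card B}"
    using finite_same_card_bij[OF fin(2), of "{1..card B}"] by auto
  obtain h where h: "bij_betw h C {1..card C}"
    using finite_same_card_bij[OF fin(3), of "{1..card C}"] by auto
  define \<phi> where "\<phi> v = (if v = x then LX else if v = y then LY else if v \<in> A then LXi (f v)
      else if v \<in> B then LYj (g v) else LZk (h v))" for v
  have disj: "A \<inter> B = {}" "A \<inter> C = {}" "B \<inter> C = {}" "x \<notin> A \<union> B \<union> C" "y \<notin> A \<union> B \<union> C"
    unfolding defs by auto
  have \<phi>_xy: "\<phi> x = LX" "\<phi> y = LY" using neq by (simp_all add: \<phi>_def)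
  have \<phi>_A: "\<phi> v = LXi (f v)" if "v \<in> A" for v
    using that disj by (auto simp: \<phi>_def)
  have \<phi>_B: "\<phi> v = LYj (g v)" if "v \<in> B" for v
    using that disj by (auto simp: \<phi>_def)
  have \<phi>_C: "\<phi> v = LZk (h v)" if "v \<in> C" for v
    using that disj by (auto simp: \<phi>_def)
  have img: "\<phi> ` A = LXi ` {1..card A}" "\<phi> ` B = LYj ` {1..card B}" "\<phi> ` C = LZk ` {1..card C}"
    using \<phi>_A \<phi>_B \<phi>_C bij_betw_imp_surj_on[OF f] bij_betw_imp_surj_on[OF g]
      bij_betw_imp_surj_on[OF h]
    by (auto simp flip: image_image cong: image_cong simp: image_iff)
  have inj: "inj_on \<phi> (pverts G)"
  proof (rule inj_onI)
    fix v w assume "v \<in> pverts G" "w \<in> pverts G" "\<phi> v = \<phi> w"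
    then show "v = w"
      unfolding verts using bij_betw_imp_inj_on[OF f] bij_betw_imp_inj_on[OF g]
        bij_betw_imp_inj_on[OF h]
      by (auto simp: \<phi>_xy \<phi>_A \<phi>_B \<phi>_C dest: inj_onD)
  qed
  have "pverts (L_graph (card A) (card B) (card C)) = \<phi> ` pverts G"
    unfolding pverts_L_graph verts by (simp add: image_Un img \<phi>_xy)
  moreover have "parcs (L_graph (card A) (card B) (card C)) = map_prod \<phi> \<phi> ` parcs G"
  proof -
    have prod: "map_prod \<phi> \<phi> ` ({p} \<times> M) = {\<phi> p} \<times> \<phi> ` M" for p M by force
    have conv: "map_prod \<phi> \<phi> ` (R\<inverse>) = (map_prod \<phi> \<phi> ` R)\<inverse>" for R by force
    show ?thesis
      unfolding parcs_L_graph arcs Let_def image_Un conv prod img[symmetric]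
      by (simp add: \<phi>_xy)
  qed
  ultimately show ?thesis unfolding digraph_iso_with_proj_iff[OF wf] using inj by blast
qed

end

section \<open>Lyubeznik edge ideals\<close>

theorem theorem3p7:
  fixes G :: "'v pair_pre_digraph"
  assumes "pair_graph G"
    and "Digraph_Component.connected (with_proj G)"
    and "parcs G \<noteq> {}"
  shows "lyubeznik_ideal (pverts G) (edge_ideal G :: ('v, 'k::field) mpoly set) \<longleftrightarrow>
    (\<exists>a b c. digraph_iso (with_proj G) (with_proj (L_graph a b c)))"
proof -
  interpret pair_graph G by (rule assms(1))
  show ?thesis
    unfolding lyubeznik_edge_ideal_iff_covering_edge[OF assms(2,3)]
    using covering_edge_if_iso[OF _ covering_edge_L_graph]
      iso_L_graph_if_covering_edge[OF assms(2)] by blast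
qed

end
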